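(* If a natural number $n$ has exactly two odd exponents in its $\varphi$-representation, then these two exponents are either $3$ and $1$, or $2i+1$ and $1-2i$ for some integer $i \ge 1$. Furthermore, each possibility occurs: there is a natural number whose $\varphi$-representation has exactly two odd exponents, namely $3$ and $1$, and for every integer $i \ge 1$ there is a natural number whose $\varphi$-representation has exactly two odd exponents, namely $2i+1$ and $1-2i$.
   Context: $\varphi = (1+\sqrt{5})/2$. Every real $x \ge 0$ has a unique $\varphi$-representation $x = \sum_{i \le t} e_i \varphi^i$ with $e_i \in \{0,1\}$, $e_i e_{i+1} = 0$ for all $i$, and no infinite tail $1010\cdots$; for natural numbers it is finite. The exponents of the representation are the integers $i$ with $e_i = 1$. *)

theory Defs
  imports "HOL-Analysis.Infinite_Sum"
begin

definition phi :: real
  where "phi = (1 + sqrt 5) / 2"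

text \<open>The third condition excludes an infinite tail 1, 0, 1, 0, ... of digits
  (read towards decreasing exponents, starting with a 1 at exponent \<open>k\<close>).\<close>

definition phi_representation :: "(int \<Rightarrow> nat) \<Rightarrow> real \<Rightarrow> bool"
  where "phi_representation e x \<longleftrightarrow>
    (\<forall>i. e i \<in> {0, 1}) \<and>
    (\<forall>i. e i * e (i + 1) = 0) \<and>
    \<not> (\<exists>k. \<forall>j::nat. e (k - 2 * int j) = 1 \<and> e (k - 2 * int j - 1) = 0) \<and>
    (\<exists>t. (\<forall>i>t. e i = 0) \<and> ((\<lambda>i. real (e i) * phi powi i) has_sum x) {..t})"

definition exponents :: "(int \<Rightarrow> nat) \<Rightarrow> int set"
  where "exponents e = {i. e i = 1}"

definition odd_exponents :: "(int \<Rightarrow> nat) \<Rightarrow> int set"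
  where "odd_exponents e = {i \<in> exponents e. odd i}"

end

theory Submission
  imports Defs "HOL-Number_Theory.Fib" "HOL-Computational_Algebra.Primes"
begin

text \<open>
  Extend the Fibonacci numbers to negative indices, so that \<open>\<phi>\<^sup>i = F(i-1) + F(i) \<phi>\<close>. Since \<open>\<phi>\<close> is
  irrational, a finite \<open>\<phi>\<close>-representation of a natural number satisfies \<open>\<Sum> F(i) = 0\<close> over its
  exponents. Even negative indices contribute negatively and odd indices positively, so with
  \<open>c k = e (2k) - e (-2k)\<close> and odd exponents \<open>p\<close>, \<open>q\<close> the condition becomes
  \<open>\<Sum> c k F(2k) + F\<bar>p\<bar> + F\<bar>q\<bar> = 0\<close>. Writing \<open>F(2A+1) = F(2A+2) - F(2A)\<close> turns this into a relation
  between the numbers \<open>F(2k)\<close> alone. These satisfy \<open>F(2k+4) = 3 F(2k+2) - F(2k)\<close>, so eliminating them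
  from the top produces integer carries \<open>m k\<close> with \<open>m 0 = 0\<close>. Digits are bounded by 1, and therefore a
  carry that starts to grow in absolute value never returns to 0; this leaves only the listed
  configurations, once one uses that digits next to \<open>p\<close> and \<open>q\<close> vanish.

  Finiteness of the representation: below all odd exponents the rescaled tail \<open>y = a + b \<phi>\<close> lies
  in \<open>[0, 1/\<phi>)\<close>, and moving two places down replaces \<open>b\<close> by \<open>a + 2b = y + (2 - \<phi>) b\<close>, which is
  strictly smaller in absolute value unless \<open>b = 0\<close>, in which case \<open>y = 0\<close>.

  The witnesses are \<open>6 = \<phi>\<^sup>3 + \<phi> + \<phi>\<^bsup>-4\<^esup>\<close>, \<open>5 = \<phi>\<^sup>3 + \<phi>\<^bsup>-1\<^esup> + \<phi>\<^bsup>-4\<^esup>\<close> and, for \<open>i \<ge> 2\<close>,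
  \<open>\<phi>\<^bsup>2i+1\<^esup> + \<phi>\<^bsup>2i-2\<^esup> + \<phi>\<^bsup>1-2i\<^esup> + \<phi>\<^bsup>-2i-2\<^esup>\<close>.
\<close>

section \<open>The golden ratio and Fibonacci numbers with integer index\<close>

lemma phi_gt_1: "phi > 1"
proof -
  have "sqrt 5 > 1" by simp
  thus ?thesis unfolding phi_def by simp
qed

lemma phi_lt_2: "phi < 2"
proof -
  have "sqrt 5 < 3" by (rule real_less_lsqrt) auto
  thus ?thesis unfolding phi_def by simp
qed

lemma phi_square: "phi * phi = phi + 1"
  unfolding phi_def by (simp add: field_simps)

lemma phi_pos [simp]: "phi > 0" and phi_nonzero [simp]: "phi \<noteq> 0"
  using phi_gt_1 by auto

text \<open>If \<open>b\<close> were nonzero, the multiplicity of the prime 5 would be odd on the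
  left and even on the right.\<close>

lemma five_times_square_eq_square_imp_zero:
  fixes b z :: int
  assumes "5 * b\<^sup>2 = z\<^sup>2"
  shows "b = 0"
proof (rule ccontr)
  assume b: "b \<noteq> 0"
  hence z: "z \<noteq> 0" using assms by auto
  have p: "prime_elem (5::int)" by simp
  have "multiplicity 5 (5 * b\<^sup>2) = Suc (2 * multiplicity 5 b)"
    using b p by (simp add: prime_elem_multiplicity_mult_distrib prime_elem_multiplicity_power_distrib)
  moreover have "multiplicity 5 (z\<^sup>2) = 2 * multiplicity 5 z"
    using z p by (simp add: prime_elem_multiplicity_power_distrib)
  ultimately have "Suc (2 * multiplicity 5 b) = 2 * multiplicity 5 z" using assms by simp
  thus False by presburger
qed

lemma int_plus_int_times_phi_eq_int:
  assumes "of_int a + of_int b * phi = of_int n"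
  shows "b = 0"
proof -
  have "of_int b * sqrt 5 = of_int (2 * (n - a) - b)"
    using assms unfolding phi_def by (simp add: field_simps)
  hence "(of_int b * sqrt 5)\<^sup>2 = (of_int (2 * (n - a) - b))\<^sup>2" by simp
  hence "of_int (5 * b\<^sup>2) = (of_int ((2 * (n - a) - b)\<^sup>2) :: real)"
    by (simp add: power_mult_distrib)
  hence "5 * b\<^sup>2 = (2 * (n - a) - b)\<^sup>2" by (simp only: of_int_eq_iff)
  thus ?thesis by (rule five_times_square_eq_square_imp_zero)
qed

text \<open>The signs are those of the negaFibonacci numbers, F(-k) = (-1)^(k+1) F(k), which extend
  the recurrence to all integers.\<close>

definition fibz :: "int \<Rightarrow> int"
  where "fibz i = (if i \<ge> 0 \<or> odd i then int (fib (nat \<bar>i\<bar>)) else - int (fib (nat \<bar>i\<bar>)))"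

lemma fibz_of_nat [simp]: "fibz (int k) = int (fib k)"
  by (simp add: fibz_def)

lemma fibz_uminus: "fibz (- i) = (if odd i then fibz i else - fibz i)"
  by (auto simp: fibz_def)

lemma fibz_odd: "odd i \<Longrightarrow> fibz i = int (fib (nat \<bar>i\<bar>))"
  by (simp add: fibz_def)

lemma fibz_add_1: "fibz (i + 1) = fibz i + fibz (i - 1)"
proof -
  have pos: "fibz (i + 1) = fibz i + fibz (i - 1)" if "i \<ge> 1" for i
  proof -
    define k where "k = nat (i - 1)"
    have "i + 1 = int (Suc (Suc k))" "i = int (Suc k)" "i - 1 = int k" using that by (auto simp: k_def)
    thus ?thesis using fib2[of k] by (simp only: fibz_of_nat of_nat_add)
  qed
  consider "i \<ge> 1" | "i = 0" | "i \<le> -1" by linarith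
  thus ?thesis
  proof cases
    case 1 thus ?thesis by (rule pos)
  next
    case 2 thus ?thesis by (simp add: fibz_def)
  next
    case 3
    hence "fibz (- i + 1) = fibz (- i) + fibz (- i - 1)" by (intro pos) simp
    thus ?thesis
      using fibz_uminus[of "i - 1"] fibz_uminus[of i] fibz_uminus[of "i + 1"]
      by (cases "even i") (simp_all add: add.commute[of 1])
  qed
qed

lemma phi_powi_eq_fibz: "phi powi i = of_int (fibz (i - 1)) + of_int (fibz i) * phi"
proof (induction i rule: int_induct[where k = 0])
  case base thus ?case by (simp add: fibz_def)
next
  case (step1 i)
  have "phi powi (i + 1) = phi powi i * phi" by (simp add: power_int_add)
  also have "\<dots> = of_int (fibz (i - 1)) * phi + of_int (fibz i) * (phi * phi)"
    by (simp add: step1 algebra_simps)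
  also have "\<dots> = of_int (fibz i) + of_int (fibz (i + 1)) * phi"
    unfolding phi_square fibz_add_1[of i] by (simp add: algebra_simps)
  finally show ?case by simp
next
  case (step2 i)
  have "phi powi (i - 1) * phi = phi powi i" by (simp add: power_int_diff)
  also have "\<dots> = of_int (fibz (i - 1)) + of_int (fibz i) * phi" by (rule step2)
  also have "\<dots> = of_int (fibz (i - 1 - 1)) * phi + of_int (fibz (i - 1)) * (phi * phi)"
    unfolding phi_square using fibz_add_1[of "i - 1"] by (simp add: algebra_simps)
  also have "\<dots> = (of_int (fibz (i - 1 - 1)) + of_int (fibz (i - 1)) * phi) * phi"
    by (simp add: algebra_simps)
  finally show ?case by simp
qed

lemma phi_powi_sum_eq_fibz:
  "(\<Sum>i\<in>S. phi powi i) = of_int (\<Sum>i\<in>S. fibz (i - 1)) + of_int (\<Sum>i\<in>S. fibz i) * phi"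
  by (simp add: phi_powi_eq_fibz sum.distrib sum_distrib_right)

lemma phi_powi_sum_eq_of_int_imp:
  assumes "(\<Sum>i\<in>S. phi powi i) = of_int n"
  shows "(\<Sum>i\<in>S. fibz i) = 0"
  using assms int_plus_int_times_phi_eq_int unfolding phi_powi_sum_eq_fibz by blast

section \<open>Finiteness of representations\<close>

text \<open>The tail is dominated by the geometric series of all even powers below \<open>s\<close>,
  whose value is \<open>phi powi (s - 1)\<close>.\<close>

lemma phi_representation_even_tail_bounds:
  assumes bin: "\<And>i. e i \<in> {0, 1::nat}"
    and no_tail: "\<not> (\<exists>k. \<forall>j::nat. e (k - 2 * int j) = 1 \<and> e (k - 2 * int j - 1) = 0)"
    and s: "even s" and odd0: "\<And>i. i < s \<Longrightarrow> odd i \<Longrightarrow> e i = 0"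
    and sum: "((\<lambda>i. real (e i) * phi powi i) has_sum T) {..<s}"
  shows "0 \<le> T" "T < phi powi (s - 1)"
proof -
  let ?f = "\<lambda>i. real (e i) * phi powi i"
  show "0 \<le> T" by (rule has_sum_nonneg[OF sum]) (simp add: less_imp_le)
  define h where "h = (\<lambda>j::nat. s - 2 - 2 * int j)"
  have "inj h" by (auto simp: h_def inj_on_def)
  have range_h: "range h = {i. i < s \<and> even i}"
  proof (intro set_eqI iffI)
    fix i assume "i \<in> {i. i < s \<and> even i}"
    hence "i = h (nat ((s - 2 - i) div 2))" using s unfolding h_def
      by (auto elim!: evenE)
    thus "i \<in> range h" by blast
  qed (use s in \<open>auto simp: h_def\<close>)
  have "(?f has_sum T) (range h) \<longleftrightarrow> (?f has_sum T) {..<s}"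
    by (rule has_sum_cong_neutral) (use odd0 in \<open>auto simp: range_h\<close>)
  hence "(?f has_sum T) (range h)" using sum by simp
  hence 1: "((?f \<circ> h) has_sum T) UNIV" using has_sum_reindex[OF \<open>inj h\<close>] by blast
  define r where "r = 1 / phi\<^sup>2"
  have r: "0 < r" "r < 1" using phi_gt_1 by (auto simp: r_def power_gt1_lemma power2_eq_square phi_square)
  have "(\<lambda>j. phi powi (s - 2) * r ^ j) sums (phi powi (s - 2) * (1 / (1 - r)))"
    using r by (intro sums_mult geometric_sums) auto
  moreover have "phi powi (s - 2) * (1 / (1 - r)) = phi powi (s - 1)"
  proof -
    have "phi powi (s - 1) = phi powi (s - 2) * phi"
      using power_int_add_1[of phi "s - 2"] by simp
    moreover have "1 / (1 - r) = phi"
      using phi_gt_1 unfolding r_def power2_eq_square phi_square by (simp add: field_simps phi_square)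
    ultimately show ?thesis by simp
  qed
  ultimately have "((\<lambda>j. phi powi (s - 2) * r ^ j) has_sum phi powi (s - 1)) UNIV"
    using r by (intro sums_nonneg_imp_has_sum) (auto simp: less_imp_le)
  moreover have pw: "phi powi (s - 2) * r ^ j = phi powi (h j)" for j
    by (simp add: h_def r_def power_int_diff power_int_mult power_divide)
  ultimately have 2: "((\<lambda>j. phi powi (h j)) has_sum phi powi (s - 1)) UNIV" by simp
  \<comment> \<open>Odd digits vanish here, so ones at all even places would form the excluded tail.
    The missing digit makes the bound strict.\<close>
  obtain j where j: "e (h j) = 0"
  proof -
    have "\<not> (\<forall>j::nat. e ((s - 2) - 2 * int j) = 1 \<and> e ((s - 2) - 2 * int j - 1) = 0)"
      using no_tail by blast
    moreover have "e ((s - 2) - 2 * int j - 1) = 0" for j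
      using s by (intro odd0) auto
    ultimately show ?thesis using bin that unfolding h_def by blast
  qed
  show "T < phi powi (s - 1)"
  proof (rule has_sum_strict_mono[OF 1 2])
    show "(?f \<circ> h) i \<le> phi powi h i" for i using bin[of "h i"] by (auto simp: less_imp_le)
    show "(?f \<circ> h) j < phi powi h j" using j by simp
  qed simp
qed

lemma phi_representation_finite_exponents:
  assumes rep: "phi_representation e (real n)" and fin: "finite (odd_exponents e)"
  shows "finite (exponents e)"
proof -
  define f where "f = (\<lambda>i. real (e i) * phi powi i)"
  obtain t where t: "\<And>i. i > t \<Longrightarrow> e i = 0" and sum_t: "(f has_sum real n) {..t}"
    using rep unfolding phi_representation_def f_def by blast
  have bin: "e i \<in> {0, 1}" for i using rep unfolding phi_representation_def by blast
  have no_tail: "\<not> (\<exists>k. \<forall>j::nat. e (k - 2 * int j) = 1 \<and> e (k - 2 * int j - 1) = 0)"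
    using rep unfolding phi_representation_def by blast
  have nonneg: "f i \<ge> 0" for i by (simp add: f_def less_imp_le)
  have sum: "(f has_sum real n) UNIV"
    using has_sum_cong_neutral[of UNIV "{..t}" f f] sum_t t by (auto simp: f_def)
  have summable: "f summable_on S" for S
    using has_sum_imp_summable[OF sum] summable_on_subset_banach by blast
  define T where "T = (\<lambda>s. infsum f {..<s})"
  have T: "(f has_sum T s) {..<s}" for s unfolding T_def using summable by simp
  obtain s0 where s0: "even s0" "\<And>i. i < s0 \<Longrightarrow> odd i \<Longrightarrow> e i = 0"
  proof -
    \<comment> \<open>Doubling gives an even number, and since the minimum is at most 0 the result
      does not exceed any odd exponent.\<close>
    define s0 where "s0 = 2 * Min (insert 0 (odd_exponents e))"
    have "e i = 0" if "i < s0" "odd i" for i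
    proof (rule ccontr)
      assume "e i \<noteq> 0"
      hence "i \<in> odd_exponents e" using bin[of i] that by (auto simp: odd_exponents_def exponents_def)
      hence "Min (insert 0 (odd_exponents e)) \<le> i" "Min (insert 0 (odd_exponents e)) \<le> 0"
        using fin by auto
      thus False using that(1) by (simp add: s0_def)
    qed
    thus ?thesis using that[of s0] by (simp add: s0_def)
  qed
  have bounds: "0 \<le> T s" "T s < phi powi (s - 1)" if "even s" "s \<le> s0" for s
    using phi_representation_even_tail_bounds[OF bin no_tail that(1), of "T s"] s0(2) that(2) T[of s]
    by (auto simp: f_def)
  have T_rec: "T s = f (s - 2) + T (s - 2)" if "even s" "s \<le> s0" for s
  proof -
    have "(f has_sum (f (s - 2) + T (s - 2))) (insert (s - 2) {..<s - 2})"
      by (intro has_sum_insert T) auto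
    moreover have "(f has_sum x) (insert (s - 2) {..<s - 2}) \<longleftrightarrow> (f has_sum x) {..<s}" for x
    proof (rule has_sum_cong_neutral)
      fix i assume "i \<in> {..<s} - insert (s - 2) {..<s - 2}"
      hence "i = s - 1" by auto
      thus "f i = 0" using s0(2)[of i] that by (simp add: f_def)
    qed auto
    ultimately show ?thesis using has_sum_unique[OF T[of s]] by blast
  qed
  have descent: "\<exists>s'. T s' = 0"
    if "even s" "s \<le> s0" "T s = phi powi s * (of_int a + of_int b * phi)" for s a b
    using that
  proof (induction "nat \<bar>b\<bar>" arbitrary: s a b rule: less_induct)
    case less
    define y where "y = of_int a + of_int b * phi"
    have "0 \<le> phi powi s * y" "phi powi s * y < phi powi s * (1 / phi)"
      using bounds[OF less.prems(1,2)] less.prems(3) by (auto simp: y_def power_int_diff)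
    moreover have "phi powi s > 0" by (simp add: zero_less_power_int)
    moreover have "1 / phi = phi - 1" by (simp add: field_simps phi_square)
    ultimately have y: "0 \<le> y" "y < phi - 1"
      by (auto simp: zero_le_mult_iff)
    show ?case
    proof (cases "b = 0")
      case True
      hence "0 \<le> real_of_int a" "real_of_int a < 1" using y phi_lt_2 by (auto simp: y_def)
      hence "a = 0" by linarith
      thus ?thesis using less.prems(3) True by auto
    next
      case False
      define d where "d = int (e (s - 2))"
      define b' where "b' = a + 2 * b"
      have "phi powi s = phi powi (s - 2) * phi\<^sup>2"
        using power_int_add[of phi "s - 2" 2] by simp
      hence "T (s - 2) = phi powi (s - 2) * (phi * phi * y - of_int d)"
        using T_rec[OF less.prems(1,2)] less.prems(3)
        by (simp add: f_def d_def y_def algebra_simps power2_eq_square)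
      also have "phi * phi * y = of_int (a + b) + of_int b' * phi"
      proof -
        have "phi * phi * y = of_int a * (phi * phi) + of_int b * (phi * phi) * phi"
          by (simp add: y_def algebra_simps)
        also have "\<dots> = of_int a * (phi + 1) + of_int b * (phi * phi) + of_int b * phi"
          unfolding phi_square by (simp add: distrib_left distrib_right mult.assoc phi_square)
        finally show ?thesis unfolding phi_square b'_def by (simp add: algebra_simps)
      qed
      finally have T': "T (s - 2) = phi powi (s - 2) * (of_int (a + b - d) + of_int b' * phi)"
        by simp
      \<comment> \<open>As \<open>2 - phi\<close> lies in (0, 1), this is a contraction of
        \<open>b\<close> up to the bounded error \<open>y\<close>.\<close>
      have b'_eq: "of_int b' = y + of_int b * (2 - phi)"
        by (simp add: b'_def y_def algebra_simps)
      have "nat \<bar>b'\<bar> < nat \<bar>b\<bar>"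
      proof (cases "b > 0")
        case True
        have "0 \<le> of_int b * (2 - phi)" using True phi_lt_2 by simp
        hence "real_of_int b' \<ge> 0" using b'_eq y by linarith
        have "1 * (phi - 1) \<le> of_int b * (phi - 1)"
          using True phi_gt_1 by (intro mult_right_mono) auto
        hence "real_of_int b' < real_of_int b" using b'_eq y by (simp add: algebra_simps)
        with \<open>real_of_int b' \<ge> 0\<close> show ?thesis by linarith
      next
        case neg: False
        hence b: "real_of_int b \<le> -1" using False by linarith
        have "of_int b * (2 - phi) \<le> -1 * (2 - phi)"
          using b phi_lt_2 by (intro mult_right_mono) auto
        hence "of_int b * (2 - phi) \<le> phi - 2" by simp
        \<comment> \<open>By integrality \<open>b' \<le> 0\<close>, so \<open>b < b'\<close> already
          makes the absolute value drop.\<close>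
        hence "real_of_int b' < 1" unfolding b'_eq using y phi_lt_2 by linarith
        have "of_int b * (phi - 1) < 0" using b phi_gt_1 by (intro mult_neg_pos) auto
        hence "real_of_int b' > real_of_int b" using b'_eq y by (simp add: algebra_simps)
        with \<open>real_of_int b' < 1\<close> show ?thesis using b by linarith
      qed
      from less.hyps[OF this _ _ T'] less.prems show ?thesis by simp
    qed
  qed
  define S where "S = {i \<in> {s0..t}. e i = 1}"
  have "(f has_sum (sum f {s0..t})) {s0..}"
    by (rule has_sum_finite_neutralI[where B = "{s0..t}"]) (use t in \<open>auto simp: f_def\<close>)
  hence "(f has_sum (T s0 + sum f {s0..t})) ({..<s0} \<union> {s0..})"
    by (intro has_sum_Un_disjoint T) auto
  moreover have "{..<s0} \<union> {s0..} = UNIV" by auto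
  ultimately have "T s0 + sum f {s0..t} = real n" using has_sum_unique[OF sum] by auto
  moreover have "sum f {s0..t} = (\<Sum>i\<in>S. phi powi i)"
    unfolding S_def f_def
  proof (rule sum.mono_neutral_cong_right)
    show "\<forall>i\<in>{s0..t} - {i \<in> {s0..t}. e i = 1}. real (e i) * phi powi i = 0"
    proof
      fix i assume "i \<in> {s0..t} - {i \<in> {s0..t}. e i = 1}"
      thus "real (e i) * phi powi i = 0" using bin[of i] by auto
    qed
  qed auto
  \<comment> \<open>Factoring out \<open>phi powi s0\<close> brings \<open>T s0\<close> into the
    form from which the descent starts.\<close>
  moreover have "(\<Sum>i\<in>S. phi powi i) = phi powi s0 * (\<Sum>i\<in>S. phi powi (i - s0))"
    by (simp add: sum_distrib_left flip: power_int_add)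
  moreover have "(\<Sum>i\<in>S. phi powi (i - s0)) = (\<Sum>i\<in>(\<lambda>i. i - s0) ` S. phi powi i)"
    by (subst sum.reindex) (auto simp: inj_on_def)
  moreover have "real n = phi powi s0 * (real n * phi powi (- s0))"
    by (simp add: power_int_minus)
  ultimately have "T s0 = phi powi s0 * (real n * phi powi (- s0) - (\<Sum>i\<in>(\<lambda>i. i - s0) ` S. phi powi i))"
    by (metis add_diff_cancel_right' right_diff_distrib)
  also have "real n * phi powi (- s0) - (\<Sum>i\<in>(\<lambda>i. i - s0) ` S. phi powi i)
    = of_int (int n * fibz (- s0 - 1) - (\<Sum>i\<in>(\<lambda>i. i - s0) ` S. fibz (i - 1)))
      + of_int (int n * fibz (- s0) - (\<Sum>i\<in>(\<lambda>i. i - s0) ` S. fibz i)) * phi"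
    unfolding phi_powi_sum_eq_fibz phi_powi_eq_fibz[of "- s0"] by (simp add: algebra_simps del: of_int_sum)
  finally obtain s where "T s = 0" using descent[of s0] s0(1) by blast
  hence "f i = 0" if "i < s" for i
    using nonneg_has_sum_le_0D[OF T[of s]] nonneg that by auto
  hence "e i = 0" if "i < s" for i using that by (auto simp: f_def)
  hence "i \<in> {s..t}" if "i \<in> exponents e" for i
    using that t[of i] by (fastforce simp: exponents_def not_less[symmetric])
  thus ?thesis by (intro finite_subset[of "exponents e" "{s..t}"]) auto
qed

section \<open>Carries in the folded representation\<close>

text \<open>Here \<open>2A + 1\<close> and \<open>2B + 1\<close> are the absolute values of the two odd exponents, and \<open>c k\<close> is the
  difference of the digits at \<open>2k\<close> and \<open>- 2k\<close>.\<close>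

locale folded_carry =
  fixes m c :: "nat \<Rightarrow> int" and A B N :: nat
  assumes carry: "m k = 3 * m (k + 1) - m (k + 2) + c (k + 1)
      + of_bool (k = A) - of_bool (k + 1 = A) + of_bool (k = B) - of_bool (k + 1 = B)"
    and digit_bound: "\<bar>c k\<bar> \<le> 1"
    and carry_eventually_zero: "k \<ge> N \<Longrightarrow> m k = 0"
    and carry_0: "m 0 = 0"
    and ordered: "A \<le> B"
begin

text \<open>Only \<open>falling\<close> is strict: the carry has to survive the odd contribution, which is
  positive where it is first met.\<close>

definition growing :: "nat \<Rightarrow> bool"
  where "growing k \<longleftrightarrow> m k \<ge> 1 \<and> m k \<ge> m (k + 1) \<and> m (k + 1) \<ge> 0"

definition falling :: "nat \<Rightarrow> bool"
  where "falling k \<longleftrightarrow> m k < m (k + 1) \<and> m (k + 1) \<le> 0"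

lemma digit_bounds: "c k \<le> 1" "c k \<ge> -1"
  using digit_bound[of k] by auto

text \<open>Without odd contributions, \<open>m k \<ge> 2 * m (k + 1) - 1 \<ge> m (k + 1)\<close>,
  even for the digit -1.\<close>

lemma growing_mono:
  assumes "growing K" "J \<le> K" "\<And>k. J \<le> k \<Longrightarrow> k < K \<Longrightarrow> k \<noteq> A \<and> k + 1 \<noteq> A \<and> k \<noteq> B \<and> k + 1 \<noteq> B"
  shows "growing J"
  using assms(2,1)
proof (induction rule: inc_induct)
  case (step k)
  thus ?case using carry[of k] assms(3)[of k] digit_bounds[of "k + 1"] by (auto simp: growing_def)
qed

text \<open>Strictness absorbs a digit 1:
  \<open>m k \<le> 2 * m (k + 1) < m (k + 1)\<close>.\<close>

lemma falling_mono:
  assumes "falling K" "J \<le> K" "\<And>k. J \<le> k \<Longrightarrow> k < K \<Longrightarrow> k \<noteq> A \<and> k + 1 \<noteq> A \<and> k \<noteq> B \<and> k + 1 \<noteq> B"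
  shows "falling J"
  using assms(2,1)
proof (induction rule: inc_induct)
  case (step k)
  thus ?case using carry[of k] assms(3)[of k] digit_bounds[of "k + 1"] by (auto simp: falling_def)
qed

lemma not_growing_0: "\<not> growing 0" and not_falling_0: "\<not> falling 0"
  using carry_0 by (auto simp: growing_def falling_def)

lemma not_growing_below: "K < A \<Longrightarrow> \<not> growing K"
  using growing_mono[of K 0] ordered not_growing_0 by force

lemma not_falling_below: "K < A \<Longrightarrow> \<not> falling K"
  using falling_mono[of K 0] ordered not_falling_0 by force

text \<open>The contribution 1 at \<open>k = A\<close> at least doubles the carry, which then
  outweighs the contribution -1 one step below.\<close>

lemma not_growing_between:
  assumes "A < K" "K < B"
  shows "\<not> growing K"
proof
  assume "growing K"
  hence g: "growing (A + 1)" using assms by (intro growing_mono[of K "A + 1"]) auto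
  have mA: "m A \<ge> 2 * m (A + 1)"
    using carry[of A] g assms digit_bounds[of "A + 1"] by (auto simp: growing_def)
  show False
  proof (cases A)
    case 0 thus False using mA g carry_0 by (simp add: growing_def)
  next
    case (Suc A')
    hence "growing A'"
      using carry[of A'] mA g assms digit_bounds[of A] by (auto simp: growing_def)
    thus False using not_growing_below[of A'] Suc by simp
  qed
qed

lemma not_falling_between:
  assumes "A < K" "K < B"
  shows "\<not> falling K"
proof
  assume "falling K"
  hence g: "falling (A + 1)" using assms by (intro falling_mono[of K "A + 1"]) auto
  have mA: "m A \<le> 2 * m (A + 1) + 1"
    using carry[of A] g assms digit_bounds[of "A + 1"] by (auto simp: falling_def)
  show False
  proof (cases A)
    case 0 thus False using mA g carry_0 by (simp add: falling_def)
  next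
    case (Suc A')
    hence "falling A'"
      using carry[of A'] mA g assms digit_bounds[of A] by (auto simp: falling_def)
    thus False using not_falling_below[of A'] Suc by simp
  qed
qed

text \<open>Downward induction from where the carry vanishes: the first nonzero digit fixes the
  sign, and no odd contribution occurs above \<open>B\<close>.\<close>

lemma above_cases:
  "m (B + 1) = 0 \<and> m (B + 2) = 0 \<or>
   m (B + 1) > m (B + 2) \<and> m (B + 2) \<ge> 0 \<or> falling (B + 1)"
proof -
  have "B + 1 \<le> B + N + 1" by simp
  hence "m (B + 1) = 0 \<and> m (B + 1 + 1) = 0 \<or>
    m (B + 1) > m (B + 1 + 1) \<and> m (B + 1 + 1) \<ge> 0 \<or> falling (B + 1)"
  proof (induction rule: inc_induct)
    case base
    thus ?case using carry_eventually_zero by simp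
  next
    case (step k)
    thus ?case using carry[of k] ordered digit_bounds[of "k + 1"] by (auto simp: falling_def)
  qed
  thus ?thesis by simp
qed

text \<open>For \<open>A = B\<close> the odd contribution counts twice; the vanishing digit
  differences compensate for this.\<close>

lemma not_falling_above:
  assumes "A = B \<Longrightarrow> c (A + 1) = 0 \<and> c A = 0"
  shows "\<not> falling (B + 1)"
proof
  assume s: "falling (B + 1)"
  have mB: "m B \<le> 2 * m (B + 1) + 1"
    using carry[of B] s assms digit_bounds[of "B + 1"] by (cases "A = B") (auto simp: falling_def)
  show False
  proof (cases B)
    case 0 thus False using mB s carry_0 by (simp add: falling_def)
  next
    case (Suc B')
    consider "A = B" | "A = B'" | "A < B'" using ordered Suc by linarith
    thus False
    proof cases
      case 1
      hence "falling B'" using carry[of B'] mB s Suc assms by (auto simp: falling_def)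
      thus False using not_falling_below[of B'] Suc 1 by simp
    next
      case 2
      \<comment> \<open>At \<open>k = A\<close> the contribution 1 of \<open>A\<close> cancels the
        contribution -1 of \<open>B = A + 1\<close>.\<close>
      have mA: "m A \<le> 2 * m B + 1"
        using carry[of A] mB s Suc 2 digit_bounds[of B] by (auto simp: falling_def)
      show False
      proof (cases A)
        case 0 thus False using mA mB s carry_0 by (simp add: falling_def)
      next
        case (Suc A')
        hence "falling A'"
          using carry[of A'] mA mB s 2 \<open>B = Suc B'\<close> digit_bounds[of A] by (auto simp: falling_def)
        thus False using not_falling_below[of A'] Suc by simp
      qed
    next
      case 3
      hence "falling B'" using carry[of B'] mB s Suc digit_bounds[of B] by (auto simp: falling_def)
      thus False using not_falling_between[of B'] 3 Suc by simp
    qed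
  qed
qed

text \<open>Stated through \<open>m B\<close> and \<open>m (B + 1)\<close> so that it also covers
  growth that starts at \<open>B\<close> itself, with \<open>m (B + 1) = 0\<close>.\<close>

lemma no_growth_through_top:
  assumes "A = B \<Longrightarrow> c (A + 1) = 0 \<and> c A = 0 \<and> m B \<ge> 2"
    and mB: "m B \<ge> 2 * m (B + 1)" "m B \<ge> 1" "m (B + 1) \<ge> 0"
  shows False
proof (cases B)
  case 0 thus False using mB carry_0 by simp
next
  case (Suc B')
  consider "A = B" | "A = B'" | "A < B'" using ordered Suc by linarith
  thus False
  proof cases
    case 1
    hence "growing B'" using carry[of B'] mB Suc assms(1) by (auto simp: growing_def)
    thus False using not_growing_below[of B'] Suc 1 by simp
  next
    case 2
    have mA: "m A \<ge> 2 * m B"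
      using carry[of A] mB Suc 2 digit_bounds[of B] by auto
    show False
    proof (cases A)
      case 0 thus False using mA mB carry_0 by simp
    next
      case (Suc A')
      hence "growing A'"
        using carry[of A'] mA mB 2 \<open>B = Suc B'\<close> digit_bounds[of A] by (auto simp: growing_def)
      thus False using not_growing_below[of A'] Suc by simp
    qed
  next
    case 3
    have "growing B'" using carry[of B'] mB Suc 3 digit_bounds[of B] by (auto simp: growing_def)
    thus False using not_growing_between[of B'] 3 Suc by simp
  qed
qed

text \<open>With growth and fall excluded above \<open>B\<close>, \<open>m B\<close> is
  \<open>c (B + 1) + 1\<close>, or 2 if \<open>A = B\<close>. It cannot be positive, which settles
  both cases.\<close>

lemma top_carry:
  assumes "A = B \<Longrightarrow> c (A + 1) = 0 \<and> c A = 0"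
  shows "A < B" "m (B + 1) = 0" "m B = 0" "c (B + 1) = -1"
proof -
  have step: "m B = 3 * m (B + 1) - m (B + 2) + c (B + 1) + 1 + of_bool (A = B)"
    using carry[of B] ordered by auto
  have "\<not> (m (B + 1) > m (B + 2) \<and> m (B + 2) \<ge> 0)"
  proof
    assume "m (B + 1) > m (B + 2) \<and> m (B + 2) \<ge> 0"
    hence "m B \<ge> 2 * m (B + 1)" "m B \<ge> 2" "m (B + 1) \<ge> 0"
      using step digit_bounds[of "B + 1"] by auto
    thus False using no_growth_through_top assms by auto
  qed
  hence zero: "m (B + 1) = 0" "m (B + 2) = 0"
    using above_cases not_falling_above[OF assms] by auto
  have "m B \<le> 0"
  proof (rule ccontr)
    assume "\<not> m B \<le> 0"
    thus False using no_growth_through_top assms step zero by auto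
  qed
  thus "A < B" "m (B + 1) = 0" "m B = 0" "c (B + 1) = -1"
    using step zero assms digit_bounds[of "B + 1"] ordered by (cases "A = B"; auto)+
qed

text \<open>If \<open>A + 1 < B\<close>, then \<open>m (B - 1) = c B - 1 < 0 = m B\<close>, so the
  carry falls between \<open>A\<close> and \<open>B\<close>.\<close>

lemma adjacent_if_nonpos:
  assumes "A = B \<Longrightarrow> c (A + 1) = 0 \<and> c A = 0" "c B \<le> 0"
  shows "B = A + 1"
proof (rule ccontr)
  assume "B \<noteq> A + 1"
  then obtain B' where B': "B = Suc B'" "A < B'"
    using top_carry(1)[OF assms(1)] by (cases B) auto
  have "falling B'"
    using carry[of B'] top_carry[OF assms(1)] B' assms(2) by (auto simp: falling_def)
  thus False using not_falling_between B' by simp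
qed

text \<open>Otherwise \<open>m A = c B\<close> and
  \<open>m (A - 1) = 3 * c B + c A - 1 < m A\<close>, so the carry falls below
  \<open>A\<close>.\<close>

lemma lower_zero_if_nonpos:
  assumes "A = B \<Longrightarrow> c (A + 1) = 0 \<and> c A = 0" "c B \<le> 0" "c A \<le> 0"
  shows "A = 0"
proof (rule ccontr)
  assume "A \<noteq> 0"
  then obtain A' where A': "A = Suc A'" by (cases A) auto
  have B: "B = A + 1" using assms by (intro adjacent_if_nonpos)
  have mA: "m A = c B"
    using carry[of A] top_carry[OF assms(1)] B by auto
  have "falling A'"
    using carry[of A'] mA A' B top_carry[OF assms(1)] assms(2,3) by (auto simp: falling_def)
  thus False using not_falling_below A' by simp
qed

end

section \<open>From the Fibonacci sum to the carries\<close>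

lemma fib_even_rec: "fib (2 * (k + 2)) + fib (2 * k) = 3 * fib (2 * (k + 1))"
  by (simp add: eval_nat_numeral)

lemma fibz_sum_fold:
  fixes d :: "int \<Rightarrow> int"
  shows "(\<Sum>j\<in>{- int L..int L}. d j * fibz (2 * j))
    = (\<Sum>k\<in>{1..L}. (d (int k) - d (- int k)) * int (fib (2 * k)))"
proof (induction L)
  case 0 thus ?case by (simp add: fibz_def)
next
  case (Suc L)
  have "{- int (Suc L)..int (Suc L)} = insert (int (Suc L)) (insert (- int (Suc L)) {- int L..int L})"
    by auto
  hence "(\<Sum>j\<in>{- int (Suc L)..int (Suc L)}. d j * fibz (2 * j))
      = d (int (Suc L)) * fibz (2 * int (Suc L)) + d (- int (Suc L)) * fibz (- (2 * int (Suc L)))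
        + (\<Sum>j\<in>{- int L..int L}. d j * fibz (2 * j))"
    by simp
  moreover have "fibz (2 * int (Suc L)) = int (fib (2 * Suc L))"
    using fibz_of_nat[of "2 * Suc L"] by simp
  ultimately show ?case using Suc
    unfolding fibz_uminus by (simp add: algebra_simps)
qed

text \<open>The recurrence is solved explicitly: \<open>m k\<close> sums the coefficients beyond
  \<open>k\<close> with weights F(2(j - k)), so \<open>m 0\<close> is the given sum.\<close>

lemma folded_carry_exists:
  fixes c :: "nat \<Rightarrow> int"
  assumes bound: "\<And>k. \<bar>c k\<bar> \<le> 1" and zero: "\<And>k. k > L \<Longrightarrow> c k = 0" and "A \<le> B"
    and sum: "(\<Sum>k\<in>{1..L}. c k * int (fib (2 * k))) + int (fib (2 * A + 1)) + int (fib (2 * B + 1)) = 0"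
  shows "\<exists>m N. folded_carry m c A B N"
proof -
  \<comment> \<open>Coefficients of F(2k) after replacing F(2A+1) by F(2A+2) - F(2A), and likewise
    for \<open>B\<close>.\<close>
  define C where "C = (\<lambda>k. c k + of_bool (k = A + 1) - of_bool (k = A) + of_bool (k = B + 1) - of_bool (k = B))"
  define M where "M = L + A + B + 2"
  define m where "m = (\<lambda>k. \<Sum>j\<in>{k<..M}. C j * int (fib (2 * (j - k))))"
  have C0: "C k = 0" if "k > M" for k using that zero by (simp add: C_def M_def)
  have m0: "m k = 0" if "k \<ge> M" for k using that by (simp add: m_def)
  \<comment> \<open>One index range serves all three carries: for \<open>l \<le> i\<close> truncated
    subtraction gives \<open>fib 0 = 0\<close>.\<close>
  have shift: "m (k + i) = (\<Sum>l\<le>M + 2. C (k + l) * int (fib (2 * (l - i))))" for k i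
  proof -
    have "m (k + i) = (\<Sum>j\<in>{k..k + (M + 2)}. C j * int (fib (2 * (j - (k + i)))))"
      unfolding m_def
      by (rule sum.mono_neutral_cong) (use C0 in \<open>auto simp: not_le not_less\<close>)
    also have "\<dots> = (\<Sum>l\<le>M + 2. C (k + l) * int (fib (2 * (l - i))))"
      by (rule sum.reindex_bij_witness[of _ "\<lambda>l. k + l" "\<lambda>j. j - k"]) auto
    finally show ?thesis .
  qed
  have rec: "m k = 3 * m (k + 1) - m (k + 2) + C (k + 1)" for k
  proof -
    \<comment> \<open>The \<open>of_bool\<close> term repairs truncation at \<open>l = 1\<close>,
      where F(2) = 1 but both other terms vanish.\<close>
    have fib_shift: "int (fib (2 * l)) = 3 * int (fib (2 * (l - 1))) - int (fib (2 * (l - 2))) + of_bool (l = 1)" for l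
    proof -
      consider "l = 0" | "l = 1" | i where "l = i + 2"
        by (metis One_nat_def add_2_eq_Suc' not0_implies_Suc)
      thus ?thesis using fib_even_rec by cases (auto simp: eval_nat_numeral)
    qed
    have "m k = (\<Sum>l\<le>M + 2. C (k + l) * int (fib (2 * l)))" using shift[of k 0] by simp
    also have "\<dots> = (\<Sum>l\<le>M + 2. 3 * (C (k + l) * int (fib (2 * (l - 1))))
        - C (k + l) * int (fib (2 * (l - 2))) + C (k + l) * of_bool (l = 1))"
      by (rule sum.cong[OF refl], subst fib_shift) (simp only: algebra_simps)
    also have "\<dots> = 3 * m (k + 1) - m (k + 2) + (\<Sum>l\<le>M + 2. C (k + l) * of_bool (l = 1))"
      by (simp only: sum.distrib sum_subtractf shift sum_distrib_left)
    also have "(\<Sum>l\<le>M + 2. C (k + l) * of_bool (l = 1)) = C (k + 1)"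
      by (simp add: of_bool_def if_distrib[of "(*) _"] sum.delta cong: if_cong)
    finally show ?thesis .
  qed
  have odd_part: "(\<Sum>k\<in>{0<..M}. (of_bool (k = A + 1) - of_bool (k = A)) * int (fib (2 * k))) = int (fib (2 * A + 1))"
    if "A < M" for A
  proof -
    have "(\<Sum>k\<in>{0<..M}. (of_bool (k = A + 1) - of_bool (k = A)) * int (fib (2 * k)))
      = (\<Sum>k\<in>{0<..M}. if k = A + 1 then int (fib (2 * k)) else 0) - (\<Sum>k\<in>{0<..M}. if k = A then int (fib (2 * k)) else 0)"
      by (subst sum_subtractf[symmetric], rule sum.cong) auto
    \<comment> \<open>For \<open>A = 0\<close> the index \<open>A\<close> lies outside the range,
      harmlessly since \<open>fib 0 = 0\<close>.\<close>
    also have "\<dots> = int (fib (2 * A + 2)) - int (fib (2 * A))"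
      using that by (cases A) simp_all
    finally show ?thesis by simp
  qed
  have "m 0 = (\<Sum>k\<in>{0<..M}. c k * int (fib (2 * k)))
      + (\<Sum>k\<in>{0<..M}. (of_bool (k = A + 1) - of_bool (k = A)) * int (fib (2 * k)))
      + (\<Sum>k\<in>{0<..M}. (of_bool (k = B + 1) - of_bool (k = B)) * int (fib (2 * k)))"
    unfolding m_def C_def sum.distrib[symmetric] by (rule sum.cong) (simp_all add: algebra_simps)
  moreover have "(\<Sum>k\<in>{0<..M}. c k * int (fib (2 * k))) = (\<Sum>k\<in>{1..L}. c k * int (fib (2 * k)))"
    by (rule sum.mono_neutral_right) (use zero in \<open>auto simp: M_def\<close>)
  ultimately have "m 0 = 0" using sum odd_part[of A] odd_part[of B] by (simp add: M_def)
  have "folded_carry m c A B M"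
  proof
    show "m k = 3 * m (k + 1) - m (k + 2) + c (k + 1)
      + of_bool (k = A) - of_bool (k + 1 = A) + of_bool (k = B) - of_bool (k + 1 = B)" for k
      by (subst rec) (simp add: C_def)
  qed (fact bound m0 \<open>m 0 = 0\<close> \<open>A \<le> B\<close>)+
  thus ?thesis by blast
qed

section \<open>Numbers with two odd exponents\<close>

lemma odd_abs_int:
  fixes i :: int
  assumes "odd i"
  obtains k :: nat where "\<bar>i\<bar> = 2 * int k + 1"
proof -
  have "odd \<bar>i\<bar>" using assms by simp
  then obtain j where "\<bar>i\<bar> = 2 * j + 1" by (elim oddE)
  hence "\<bar>i\<bar> = 2 * int (nat j) + 1" by linarith
  thus ?thesis by (rule that)
qed

lemma odd_exponent_pair_classification:
  assumes bin: "\<And>i. e i \<in> {0, 1::nat}" and adj: "\<And>i. e i * e (i + 1) = 0"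
    and fin: "finite (exponents e)" and sum0: "(\<Sum>i\<in>exponents e. fibz i) = 0"
    and odds: "odd_exponents e = {p, q}" "p \<noteq> q" and le: "\<bar>p\<bar> \<le> \<bar>q\<bar>"
  shows "p = 1 \<and> q = 3 \<or> (\<exists>i\<ge>1. q = 2 * i + 1 \<and> p = 1 - 2 * i)"
proof -
  define c where "c = (\<lambda>k::nat. int (e (2 * int k)) - int (e (- 2 * int k)))"
  define L where "L = nat (Max ((\<lambda>i. \<bar>i\<bar>) ` insert 0 (exponents e)))"
  have L: "\<bar>i\<bar> \<le> int L" if "e i \<noteq> 0" for i
  proof -
    have "i \<in> exponents e" using that bin[of i] by (auto simp: exponents_def)
    hence "\<bar>i\<bar> \<le> Max ((\<lambda>i. \<bar>i\<bar>) ` insert 0 (exponents e))" using fin by (intro Max_ge) auto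
    thus ?thesis unfolding L_def by linarith
  qed
  have pq: "e p = 1" "odd p" "e q = 1" "odd q"
    using odds(1) by (auto simp: odd_exponents_def exponents_def)
  obtain A where A: "\<bar>p\<bar> = 2 * int A + 1"
    using pq(2) by (rule odd_abs_int)
  obtain B where B: "\<bar>q\<bar> = 2 * int B + 1"
    using pq(4) by (rule odd_abs_int)
  have near: "e (i + 1) = 0" "e (i - 1) = 0" if "e i = 1" for i
    using adj[of i] adj[of "i - 1"] that by auto
  have bound: "\<bar>c k\<bar> \<le> 1" for k
    using bin[of "2 * int k"] bin[of "- 2 * int k"] by (auto simp: c_def)
  have zero: "c k = 0" if "k > L" for k
  proof -
    have "e (2 * int k) = 0" using L[of "2 * int k"] that by force
    moreover have "e (- 2 * int k) = 0" using L[of "- 2 * int k"] that by force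
    ultimately show ?thesis by (simp add: c_def)
  qed
  \<comment> \<open>Both even neighbours of a positive odd exponent have digit 0, leaving only the
    negatively counted digits; \<open>sign'\<close> is the mirror image.\<close>
  have sign: "c (n + 1) \<le> 0 \<and> c n \<le> 0" if "e i = 1" "i = 2 * int n + 1" for i n
    using near[OF that(1)] that(2) by (simp add: c_def algebra_simps)
  have sign': "c (n + 1) \<ge> 0 \<and> c n \<ge> 0" if "e i = 1" "i = - (2 * int n + 1)" for i n
    using near[OF that(1)] that(2) by (simp add: c_def algebra_simps)
  have "(\<Sum>i\<in>exponents e. fibz i) = (\<Sum>i\<in>{i\<in>exponents e. even i}. fibz i) + (\<Sum>i\<in>odd_exponents e. fibz i)"
    unfolding odd_exponents_def
    by (subst sum.union_disjoint[symmetric]) (use fin in \<open>auto intro: sum.cong\<close>)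
  moreover have "(\<Sum>i\<in>odd_exponents e. fibz i) = int (fib (2 * A + 1)) + int (fib (2 * B + 1))"
    using odds A B pq by (simp add: fibz_odd nat_add_distrib nat_mult_distrib)
  moreover have "(\<Sum>i\<in>{i\<in>exponents e. even i}. fibz i)
      = (\<Sum>j\<in>{j\<in>{- int L..int L}. e (2 * j) = 1}. fibz (2 * j))"
  proof (rule sum.reindex_bij_witness[of _ "\<lambda>j. 2 * j" "\<lambda>i. i div 2"])
    fix i assume "i \<in> {i \<in> exponents e. even i}"
    hence i: "e i = 1" "2 * (i div 2) = i" by (auto simp: exponents_def)
    moreover have "\<bar>i\<bar> \<le> int L" using L[of i] i(1) by simp
    ultimately show "i div 2 \<in> {j \<in> {- int L..int L}. e (2 * j) = 1}" by auto
  qed (auto simp: exponents_def)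
  moreover have "\<dots> = (\<Sum>j\<in>{- int L..int L}. int (e (2 * j)) * fibz (2 * j))"
  proof (rule sum.mono_neutral_cong_left)
    show "\<forall>j\<in>{- int L..int L} - {j\<in>{- int L..int L}. e (2 * j) = 1}. int (e (2 * j)) * fibz (2 * j) = 0"
    proof
      fix j assume "j \<in> {- int L..int L} - {j\<in>{- int L..int L}. e (2 * j) = 1}"
      thus "int (e (2 * j)) * fibz (2 * j) = 0" using bin[of "2 * j"] by auto
    qed
  qed auto
  moreover have "\<dots> = (\<Sum>k\<in>{1..L}. c k * int (fib (2 * k)))"
    using fibz_sum_fold[of "\<lambda>j. int (e (2 * j))" L] by (simp add: c_def)
  ultimately have "(\<Sum>k\<in>{1..L}. c k * int (fib (2 * k))) + int (fib (2 * A + 1)) + int (fib (2 * B + 1)) = 0"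
    using sum0 by simp
  moreover have "A \<le> B" using A B le by simp
  ultimately obtain m N where "folded_carry m c A B N"
    using folded_carry_exists[of c L A B] bound zero by blast
  then interpret folded_carry m c A B N .
  \<comment> \<open>Here \<open>p = - q\<close>, so both sign constraints apply at once.\<close>
  have same: "c (A + 1) = 0 \<and> c A = 0" if "A = B"
  proof -
    have "p = - q" using that A B odds(2) by linarith
    thus ?thesis
    proof (cases "q > 0")
      case True
      hence "q = 2 * int A + 1" "p = - (2 * int A + 1)" using B that \<open>p = - q\<close> by auto
      thus ?thesis using sign[OF pq(3)] sign'[OF pq(1)] by force
    next
      case False
      hence "p = 2 * int A + 1" "q = - (2 * int A + 1)" using B that \<open>p = - q\<close> by auto
      thus ?thesis using sign[OF pq(1)] sign'[OF pq(3)] by force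
    qed
  qed
  have "c (B + 1) = -1" by (rule top_carry(4)) (fact same)
  have q: "q > 0"
  proof (rule ccontr)
    assume "\<not> q > 0"
    hence "q = - (2 * int B + 1)" using B by simp
    thus False using sign'[OF pq(3)] \<open>c (B + 1) = -1\<close> by force
  qed
  hence q_eq: "q = 2 * int B + 1" using B by simp
  have cB: "c B \<le> 0" using sign[OF pq(3) q_eq] by simp
  have AB: "B = A + 1" by (rule adjacent_if_nonpos) (fact same cB)+
  show ?thesis
  proof (cases "p > 0")
    case True
    hence "c A \<le> 0" using sign[of p A] A pq by simp
    hence "A = 0" by (intro lower_zero_if_nonpos same cB)
    thus ?thesis using True A AB q_eq by simp
  next
    case False
    \<comment> \<open>The parameter is \<open>i = A + 1 = B\<close>.\<close>
    hence "q = 2 * int (A + 1) + 1 \<and> p = 1 - 2 * int (A + 1)" using A AB q_eq by simp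
    thus ?thesis by (intro disjI2 exI[of _ "int (A + 1)"]) simp
  qed
qed

section \<open>Realising the listed pairs\<close>

lemma phi_representation_indicator:
  assumes "finite S" "\<And>i. i \<in> S \<Longrightarrow> i + 1 \<notin> S" "(\<Sum>i\<in>S. phi powi i) = x"
  shows "phi_representation (\<lambda>i. if i \<in> S then 1 else 0) x"
proof -
  let ?e = "\<lambda>i. if i \<in> S then 1 else 0 :: nat"
  have no_tail: "\<not> (\<exists>k. \<forall>j::nat. ?e (k - 2 * int j) = 1 \<and> ?e (k - 2 * int j - 1) = 0)"
  proof
    assume "\<exists>k. \<forall>j::nat. ?e (k - 2 * int j) = 1 \<and> ?e (k - 2 * int j - 1) = 0"
    then obtain k where k: "\<And>j::nat. ?e (k - 2 * int j) = 1" by blast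
    have "range (\<lambda>j::nat. k - 2 * int j) \<subseteq> S"
      using k by (metis (mono_tags) image_subsetI zero_neq_one)
    moreover have "infinite (range (\<lambda>j::nat. k - 2 * int j))"
      by (rule range_inj_infinite) (auto simp: inj_on_def)
    ultimately show False using assms(1) finite_subset by blast
  qed
  define t where "t = Max (insert 0 S)"
  have t: "S \<subseteq> {..t}" using assms(1) by (auto simp: t_def)
  have "((\<lambda>i. real (?e i) * phi powi i) has_sum x) {..t}"
  proof (rule has_sum_finite_neutralI[where B = S])
    show "x = (\<Sum>i\<in>S. real (?e i) * phi powi i)" using assms(3) by simp
  qed (use t assms(1) in auto)
  moreover have "\<forall>i>t. ?e i = 0" using t by auto
  moreover have "\<forall>i. ?e i * ?e (i + 1) = 0" using assms(2) by simp
  moreover have "\<forall>i. ?e i \<in> {0, 1}" by simp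
  ultimately show ?thesis unfolding phi_representation_def using no_tail by blast
qed

text \<open>A vanishing coefficient of \<open>phi\<close> leaves an integer, nonnegative as a sum of
  powers of \<open>phi\<close>.\<close>

lemma exists_nat_phi_representation:
  assumes "finite S" "\<And>i. i \<in> S \<Longrightarrow> i + 1 \<notin> S" "(\<Sum>i\<in>S. fibz i) = 0" "{i \<in> S. odd i} = Q"
  shows "\<exists>(n::nat) e. phi_representation e (real n) \<and> odd_exponents e = Q"
proof -
  define z where "z = (\<Sum>i\<in>S. fibz (i - 1))"
  have eq: "(\<Sum>i\<in>S. phi powi i) = of_int z"
    using assms(3) by (simp add: phi_powi_sum_eq_fibz z_def del: of_int_sum)
  moreover have "(\<Sum>i\<in>S. phi powi i) \<ge> 0" by (intro sum_nonneg zero_le_power_int) (simp add: less_imp_le)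
  ultimately have "(\<Sum>i\<in>S. phi powi i) = real (nat z)" by simp
  hence "phi_representation (\<lambda>i. if i \<in> S then 1 else 0) (real (nat z))"
    using assms by (intro phi_representation_indicator) auto
  moreover have "odd_exponents (\<lambda>i. if i \<in> S then 1 else 0) = Q"
    using assms(4) by (auto simp: odd_exponents_def exponents_def)
  ultimately show ?thesis by blast
qed

lemma exists_phi_representation_odd_exponents_3_1:
  "\<exists>(n::nat) e. phi_representation e (real n) \<and> odd_exponents e = {3, 1}"
  by (rule exists_nat_phi_representation[where S = "{3, 1, -4}"])
     (auto simp: fibz_def numeral_eq_Suc)

lemma exists_phi_representation_odd_exponents_symmetric:
  assumes "i \<ge> 1"
  shows "\<exists>(n::nat) e. phi_representation e (real n) \<and> odd_exponents e = {2 * i + 1, 1 - 2 * i}"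
proof (cases "i = 1")
  case True
  \<comment> \<open>The general witness would contain the adjacent exponents 0 and -1; dropping 0 is
    free because F(0) = 0.\<close>
  have "\<exists>(n::nat) e. phi_representation e (real n) \<and> odd_exponents e = {3, -1}"
    by (rule exists_nat_phi_representation[where S = "{3, -1, -4}"])
       (auto simp: fibz_def numeral_eq_Suc)
  thus ?thesis using True by simp
next
  case False
  hence i: "i \<ge> 2" using assms by simp
  show ?thesis
  proof (rule exists_nat_phi_representation)
    \<comment> \<open>F(2i+2) = F(2i+1) + F(2i-1) + F(2i-2), and reflection turns F(2i-1) into
      F(1-2i) and F(2i+2) into -F(-2i-2).\<close>
    let ?S = "{2 * i + 1, 2 * i - 2, 1 - 2 * i, - 2 * i - 2}"
    have "fibz (2 * i + 2) = fibz (2 * i + 1) + fibz (2 * i - 1) + fibz (2 * i - 2)"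
      using fibz_add_1[of "2 * i + 1"] fibz_add_1[of "2 * i - 1"] by (simp add: add.commute)
    moreover have "fibz (- 2 * i - 2) = - fibz (2 * i + 2)"
      using fibz_uminus[of "2 * i + 2"] by simp
    moreover have "fibz (1 - 2 * i) = fibz (2 * i - 1)"
      using fibz_uminus[of "2 * i - 1"] by simp
    ultimately show "(\<Sum>j\<in>?S. fibz j) = 0" using i by simp
    show "{j \<in> ?S. odd j} = {2 * i + 1, 1 - 2 * i}" by auto
    show "j + 1 \<notin> ?S" if "j \<in> ?S" for j using that i by auto
  qed simp
qed

theorem theorem9:
  shows "(\<forall>(n::nat) e. phi_representation e (real n) \<and> card (odd_exponents e) = 2 \<longrightarrow>
            odd_exponents e = {3, 1} \<or>
            (\<exists>i::int. i \<ge> 1 \<and> odd_exponents e = {2 * i + 1, 1 - 2 * i}))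
       \<and> (\<exists>(n::nat) e. phi_representation e (real n) \<and> odd_exponents e = {3, 1})
       \<and> (\<forall>i::int. i \<ge> 1 \<longrightarrow>
            (\<exists>(n::nat) e. phi_representation e (real n) \<and>
               odd_exponents e = {2 * i + 1, 1 - 2 * i}))"
proof (intro conjI allI impI)
  fix n :: nat and e
  assume rep: "phi_representation e (real n) \<and> card (odd_exponents e) = 2"
  then obtain p q where pq: "odd_exponents e = {p, q}" "p \<noteq> q" "\<bar>p\<bar> \<le> \<bar>q\<bar>"
    by (metis card_2_iff insert_commute linear)
  have bin: "e i \<in> {0, 1}" and adj: "e i * e (i + 1) = 0" for i
    using rep unfolding phi_representation_def by blast+
  have fin: "finite (exponents e)"
    using phi_representation_finite_exponents[of e n] rep pq(1) by simp
  obtain t where "((\<lambda>i. real (e i) * phi powi i) has_sum real n) {..t}" "\<And>i. i > t \<Longrightarrow> e i = 0"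
    using rep unfolding phi_representation_def by blast
  \<comment> \<open>By finiteness the series is also this finite sum, so uniqueness of the limit
    equates it with \<open>n\<close>.\<close>
  moreover have "((\<lambda>i. real (e i) * phi powi i) has_sum (\<Sum>i\<in>exponents e. phi powi i)) {..t}"
  proof (rule has_sum_finite_neutralI[OF fin])
    show "exponents e \<subseteq> {..t}"
      using calculation(2) by (force simp: exponents_def not_less[symmetric])
    show "real (e i) * phi powi i = 0" if "i \<in> {..t} - exponents e" for i
      using that bin[of i] by (auto simp: exponents_def)
  qed (simp add: exponents_def)
  ultimately have "(\<Sum>i\<in>exponents e. phi powi i) = of_int (int n)"
    using has_sum_unique by fastforce
  hence "(\<Sum>i\<in>exponents e. fibz i) = 0" by (rule phi_powi_sum_eq_of_int_imp)
  from odd_exponent_pair_classification[OF bin adj fin this pq]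
  show "odd_exponents e = {3, 1} \<or> (\<exists>i::int. i \<ge> 1 \<and> odd_exponents e = {2 * i + 1, 1 - 2 * i})"
    using pq(1) by (auto simp: insert_commute)
qed (simp_all add: exists_phi_representation_odd_exponents_3_1
       exists_phi_representation_odd_exponents_symmetric)

end
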